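(* Let $w$ be an overlap-free word over the binary alphabet $\{0,1\}$, and let $M(w)$ denote the number of positions of $w$ that are centres of squares in $w$. Then $M(w) \le \left\lceil \frac{|w|}{2} \right\rceil + 1$, i.e., $2M(w) \le |w| + 3$.
   Context: Words are finite words over the alphabet $\{0,1\}$, and $|w|$ denotes the length of $w$. A word $u$ is a factor of $w$ if $w = xuy$ for some (possibly empty) words $x, y$. An overlap is a word of the form $uvuvu$ where $u$ is a nonempty word ($v$ may be empty). A word is overlap-free if none of its factors is an overlap. A position in $w$ is an integer $p$ with $1 \le p < |w|$; it denotes the place after the prefix of length $p$. Write $w = xy$ with $|x| = p$. The position $p$ is a centre of a square in $w$ if there is a nonempty word $u$ and possibly empty words $x', y'$ such that $x = x'u$ and $y = uy'$. Define $M(w) = \#\{p \mid p \text{ is a centre of a square in } w\}$ (each position is counted at most once). *)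

theory Defs
  imports Complex_Main "HOL-Library.Sublist"
begin

text \<open>The letters 0 and 1 are represented by \<^const>\<open>False\<close> and \<^const>\<open>True\<close>.\<close>
type_synonym binary_word = "bool list"

definition is_overlap :: "'a list \<Rightarrow> bool" where
  "is_overlap z \<longleftrightarrow> (\<exists>u v. u \<noteq> [] \<and> z = u @ v @ u @ v @ u)"

definition overlap_free :: "'a list \<Rightarrow> bool" where
  "overlap_free w \<longleftrightarrow> (\<forall>z. sublist z w \<longrightarrow> \<not> is_overlap z)"

text \<open>Position \<open>p\<close> is the place after the prefix of length \<open>p\<close>.\<close>
definition square_centre :: "'a list \<Rightarrow> nat \<Rightarrow> bool" where
  "square_centre w p \<longleftrightarrow> 1 \<le> p \<and> p < length w \<and>
     (\<exists>u x' y'. u \<noteq> [] \<and> take p w = x' @ u \<and> drop p w = u @ y')"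

definition M :: "'a list \<Rightarrow> nat" where
  "M w = card {p. square_centre w p}"

end

theory Submission
  imports Defs
begin

text \<open>
  Let \<open>E\<close> be the set of positions between two equal letters. Overlap-freeness forces consecutive
  elements of \<open>E\<close> to be at distance 2, 3 or 4, and distance 3 means an occurrence of the factor
  00100 or 11011, which can only be a prefix (case \<open>L\<close>) or a suffix (case \<open>R\<close>): extended by a letter
  on both sides it contains an overlap. Hence, apart from the first or the last position in these
  two cases, all of \<open>E\<close> has one parity. A square centre of the other parity is caused by \<open>L\<close> or \<open>R\<close>
  (at distance 1 or 3 from an end), or is the centre of a square of even half-length covering all
  of the word but at most one letter at each end, which leaves one such position. Half of the
  positions have the main parity, and \<open>L\<close> and \<open>R\<close> each exclude one of these, namely the one at
  distance 2 from the end. If both \<open>L\<close> and \<open>R\<close> hold, the long square does not occur.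
\<close>

section \<open>Overlaps and squares as equations between letters\<close>

text \<open>A factor of length \<open>2 * m + 1\<close> with period \<open>m\<close> is an overlap:
  take its first letter as \<open>u\<close> and the next \<open>m - 1\<close> letters as
  \<open>v\<close>.\<close>

lemma overlap_free_nth:
  assumes "overlap_free w" "0 < m" "a + 2 * m < length w"
  shows "\<exists>i\<le>m. w ! (a + i) \<noteq> w ! (a + m + i)"
proof (rule ccontr)
  assume "\<not> ?thesis"
  then have eq: "w ! (a + i) = w ! (a + m + i)" if "i \<le> m" for i
    using that by blast
  define u v where "u = [w ! a]" and "v = take (m - 1) (drop (a + 1) w)"
  have "take m (drop a w) = u @ v"
    using assms unfolding u_def v_def
    by (cases m) (auto simp: Cons_nth_drop_Suc[symmetric])
  moreover have "take m (drop (a + m) w) = take m (drop a w)"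
    using assms eq by (intro nth_equalityI) (simp_all add: less_imp_le)
  moreover have "take 1 (drop (a + 2 * m) w) = u"
    using assms eq[of 0] eq[of m] unfolding u_def
    by (simp add: take_Suc_conv_app_nth mult_2 add.assoc)
  moreover have "take (2 * m + 1) (drop a w)
      = take m (drop a w) @ take m (drop (a + m) w) @ take 1 (drop (a + 2 * m) w)"
    unfolding mult_2 by (simp only: take_add drop_drop) (simp add: ac_simps)
  ultimately have "take (2 * m + 1) (drop a w) = u @ v @ u @ v @ u"
    by simp
  moreover have "sublist (take (2 * m + 1) (drop a w)) w"
    by (meson sublist_drop sublist_take sublist_order.order.trans)
  ultimately show False
    using assms(1) unfolding overlap_free_def is_overlap_def u_def by blast
qed

lemma square_centreE:
  assumes "square_centre w p"
  obtains a m where "0 < m" "p = a + m" "a + 2 * m \<le> length w"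
    "\<And>i. i < m \<Longrightarrow> w ! (a + i) = w ! (a + m + i)"
proof -
  obtain u x y where u: "u \<noteq> []" and t: "take p w = x @ u" and d: "drop p w = u @ y"
    and p: "p < length w"
    using assms unfolding square_centre_def by blast
  have len: "p = length x + length u"
    using arg_cong[OF t, of length] p by simp
  have w: "w = x @ u @ u @ y"
    using t d by (metis append.assoc append_take_drop_id)
  have "length x + 2 * length u \<le> length w"
    by (simp add: w)
  moreover have "w ! (length x + i) = w ! (length x + length u + i)" if "i < length u" for i
    using that by (simp add: w nth_append)
  ultimately show thesis
    using that[of "length u" "length x"] u len by simp
qed

section \<open>Distances between repeated letters\<close>

locale overlap_free_word =
  fixes w :: binary_word
  assumes ovf: "overlap_free w"
begin

abbreviation n :: nat where "n \<equiv> length w"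

definition E :: "nat \<Rightarrow> bool" where
  "E p \<longleftrightarrow> 0 < p \<and> p < n \<and> w ! (p - 1) = w ! p"

definition L :: bool where "L \<longleftrightarrow> E 1 \<and> E 4"
text \<open>For \<open>n \<le> 4\<close> the truncated difference \<open>n - 4\<close> is 0, which
  \<open>E\<close> excludes, so \<open>R\<close> implies \<open>5 \<le> n\<close>.\<close>

definition R :: bool where "R \<longleftrightarrow> E (n - 4) \<and> E (n - 1)"

lemma E_Suc: "E (Suc i) \<longleftrightarrow> Suc i < n \<and> w ! i = w ! Suc i"
  by (simp add: E_def)

lemma E_pos: "E p \<Longrightarrow> 0 < p"
  and E_less: "E p \<Longrightarrow> p < n"
  by (simp_all add: E_def)

text \<open>Otherwise three consecutive letters coincide, an overlap of period 1.\<close>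

lemma not_E_Suc:
  assumes "E p" shows "\<not> E (Suc p)"
proof
  assume "E (Suc p)"
  obtain i where p: "p = Suc i" using E_pos[OF assms] gr0_conv_Suc by auto
  show False
    using overlap_free_nth[OF ovf, of 1 i] assms \<open>E (Suc p)\<close>
    by (auto simp: p E_Suc le_Suc_eq)
qed

text \<open>Otherwise five consecutive letters alternate, an overlap of period 2.\<close>

lemma E_window:
  assumes "0 < p" "p + 3 < n"
  shows "E p \<or> E (p + 1) \<or> E (p + 2) \<or> E (p + 3)"
proof -
  obtain i where p: "p = Suc i" using assms gr0_conv_Suc by auto
  show ?thesis
    using overlap_free_nth[OF ovf, of 2 i] assms
    by (auto simp: p E_Suc le_Suc_eq numeral_eq_Suc)
qed

text \<open>Away from the ends, \<open>not_E_Suc\<close> determines all letters around the gap: they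
  read baabaab, an overlap of period 3.\<close>

lemma E_gap3:
  assumes "E p" "E (p + 3)"
  shows "p = 1 \<or> p + 4 = n"
proof (rule ccontr)
  assume neg: "\<not> ?thesis"
  have "p \<noteq> 0" using E_pos[OF assms(1)] by simp
  then obtain i where p: "p = Suc (Suc i)" using neg by (metis One_nat_def not0_implies_Suc)
  have n: "i + 6 < n" using E_less[OF assms(2)] neg p by simp
  have "\<not> E (p + 1)" "\<not> E (p + 2)" "\<not> E (p + 4)" "\<not> E (Suc i)"
    using not_E_Suc[of p] not_E_Suc[of "p + 2"] not_E_Suc[of "p + 3"] not_E_Suc[of "Suc i"]
      assms p by (auto simp: numeral_eq_Suc)
  then show False
    using overlap_free_nth[OF ovf, of 3 i] assms n
    by (auto simp: p E_Suc le_Suc_eq numeral_eq_Suc)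
qed

text \<open>Distances between consecutive elements of \<open>E\<close> are 2, 3 or 4, so an odd distance contains a 3.\<close>
lemma E_odd_distance:
  assumes "E e" "E f" "e < f" "odd (f - e)"
  shows "e = 1 \<and> L \<or> f = n - 1 \<and> R"
proof -
  have "\<exists>g. e \<le> g \<and> g + 3 \<le> f \<and> E g \<and> E (g + 3)"
    using assms
  proof (induction "f - e" arbitrary: e rule: less_induct)
    case less
    have f1: "f \<noteq> e + 1" using not_E_Suc less.prems by auto
    have f2: "f \<noteq> e + 2" "f \<noteq> e + 4" using less.prems by auto
    \<comment> \<open>Gaps of 2 or 4 keep the distance to \<open>f\<close> odd, so the induction can
      pass to the next element.\<close>
    have step: ?case if "E e'" "e < e'" "e' < f" "even (e' - e)" for e'
    proof -
      have "\<exists>g. e' \<le> g \<and> g + 3 \<le> f \<and> E g \<and> E (g + 3)"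
        by (rule less.hyps) (use that less.prems in auto)
      then show ?thesis using that by (meson le_trans less_imp_le)
    qed
    show ?case
    proof (cases "f = e + 3")
      case True
      then show ?thesis using less.prems by auto
    next
      case False
      then have f: "e + 4 < f" using f1 f2 less.prems by linarith
      have "E (e + 1) \<or> E (e + 2) \<or> E (e + 3) \<or> E (e + 4)"
        using E_window[of "e + 1"] f E_less[OF less.prems(2)] by (simp add: numeral_eq_Suc)
      moreover have "\<not> E (e + 1)" using not_E_Suc less.prems by simp
      ultimately show ?thesis
        using step[of "e + 2"] step[of "e + 4"] f less.prems(1) by auto
    qed
  qed
  then obtain g where g: "e \<le> g" "g + 3 \<le> f" "E g" "E (g + 3)" by blast
  from E_gap3[OF g(3,4)] show ?thesis
  proof
    assume "g = 1"
    then show ?thesis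
      using g E_pos[OF assms(1)] by (auto simp: L_def)
  next
    assume "g + 4 = n"
    then have "g = n - 4" "g + 3 = n - 1" by auto
    then show ?thesis using g E_less[OF assms(2)] by (auto simp: R_def)
  qed
qed

section \<open>The exceptional prefix and suffix\<close>

lemma L_letters:
  assumes L
  shows "w ! 1 = w ! 0" "w ! 2 = (\<not> w ! 0)" "w ! 3 = w ! 0" "w ! 4 = w ! 0"
proof -
  have "E 1" "E 4" using assms by (auto simp: L_def)
  moreover have "\<not> E 2" "\<not> E 3"
    using not_E_Suc[of 1] not_E_Suc[of 3] \<open>E 1\<close> \<open>E 4\<close> by (auto simp: numeral_eq_Suc)
  ultimately show "w ! 1 = w ! 0" "w ! 2 = (\<not> w ! 0)" "w ! 3 = w ! 0" "w ! 4 = w ! 0"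
    by (auto simp: E_Suc numeral_eq_Suc)
qed

lemma R_letters:
  assumes R "n = k + 5"
  shows "w ! (k + 1) = w ! k" "w ! (k + 2) = (\<not> w ! k)" "w ! (k + 3) = w ! k" "w ! (k + 4) = w ! k"
proof -
  have "E (k + 1)" "E (k + 4)" using assms by (auto simp: R_def add.commute[of k])
  moreover have "\<not> E (k + 2)" "\<not> E (k + 3)"
    using not_E_Suc[of "k + 1"] not_E_Suc[of "k + 3"] \<open>E (k + 1)\<close> \<open>E (k + 4)\<close>
    by (auto simp: numeral_eq_Suc)
  ultimately show "w ! (k + 1) = w ! k" "w ! (k + 2) = (\<not> w ! k)"
    "w ! (k + 3) = w ! k" "w ! (k + 4) = w ! k"
    using assms(2) by (auto simp: E_Suc numeral_eq_Suc)
qed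

text \<open>Only half-lengths 1 and 2 fit to the left of position 2, and the prefix aabaa rules out
  both. \<open>R_not_centre\<close> is the mirror image.\<close>

lemma L_not_centre:
  assumes L shows "\<not> square_centre w 2"
proof
  assume "square_centre w 2"
  then obtain a m where am: "0 < m" "2 = a + m" "\<And>i. i < m \<Longrightarrow> w ! (a + i) = w ! (a + m + i)"
    by (rule square_centreE) blast
  then have "a = 1 \<and> m = 1 \<or> a = 0 \<and> m = 2" by linarith
  then show False
    using am(3)[of 0] L_letters[OF assms] by (auto simp: numeral_eq_Suc)
qed

lemma R_not_centre:
  assumes R "6 \<le> n" shows "\<not> square_centre w (n - 2)"
proof
  define k where "k = n - 5"
  have k: "n = k + 5" using assms(2) by (simp add: k_def)
  assume "square_centre w (n - 2)"
  then obtain a m where am: "0 < m" "n - 2 = a + m" "a + 2 * m \<le> n"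
    "\<And>i. i < m \<Longrightarrow> w ! (a + i) = w ! (a + m + i)"
    by (rule square_centreE) blast
  then have "a = k + 2 \<and> m = 1 \<or> a = k + 1 \<and> m = 2" using k by linarith
  then show False
  proof
    assume "a = k + 2 \<and> m = 1"
    then show False using am(4)[of 0] R_letters[OF assms(1) k] by (simp add: numeral_eq_Suc)
  next
    assume "a = k + 1 \<and> m = 2"
    then show False using am(4)[of 1] R_letters[OF assms(1) k] by (simp add: numeral_eq_Suc)
  qed
qed

section \<open>The common parity of the repetitions\<close>

text \<open>Any non-exceptional element of \<open>E\<close> can serve as \<open>c\<close>: two of
  them at odd distance would contradict \<open>E_odd_distance\<close>.\<close>

lemma E_parity:
  assumes "6 \<le> n"
  obtains c :: nat where "\<And>e. E e \<Longrightarrow> even (e + c) \<or> e = 1 \<and> L \<or> e = n - 1 \<and> R"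
    "L \<Longrightarrow> even c" "R \<Longrightarrow> even (n + c)"
proof -
  define good where "good e \<longleftrightarrow> E e \<and> \<not> (e = 1 \<and> L) \<and> \<not> (e = n - 1 \<and> R)" for e
  have same: "even (e + f)" if "good e" "good f" for e f
  proof (rule ccontr)
    assume odd: "odd (e + f)"
    then have "e \<noteq> f" by auto
    then consider "e < f" "odd (f - e)" | "f < e" "odd (e - f)"
      using odd by (cases "e < f") auto
    then show False
      using E_odd_distance[of e f] E_odd_distance[of f e] that unfolding good_def
      by cases auto
  qed
  \<comment> \<open>The inner repetitions 4 and \<open>n - 4\<close> are not exceptional, since
    \<open>6 \<le> n\<close> separates them from \<open>n - 1\<close> and 1. They tie the parity of
    \<open>c\<close> to \<open>L\<close> and \<open>R\<close>.\<close>
  have gL: "good 4" if L using that assms by (auto simp: good_def L_def R_def)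
  have gR: "good (n - 4)" if R using that assms by (auto simp: good_def R_def L_def)
  have "\<exists>c. good c"
  proof (cases "L \<or> R")
    case False
    then show ?thesis using E_window[of 1] assms unfolding good_def by auto
  qed (use gL gR in blast)
  then obtain c where c: "good c" ..
  show thesis
  proof (rule that)
    show "even (e + c) \<or> e = 1 \<and> L \<or> e = n - 1 \<and> R" if "E e" for e
      using same[OF _ c] that unfolding good_def by blast
    show "even c" if L using same[OF gL[OF that] c] by simp
    show "even (n + c)" if R using same[OF gR[OF that] c] assms by simp
  qed
qed

section \<open>Square centres of the other parity\<close>

text \<open>The first half has an element of \<open>E\<close> in its interior, and the copy in the
  second half is at odd distance \<open>m\<close>. So one of the two is the exceptional position at
  an end of the word.\<close>

lemma no_odd_square:
  assumes "5 \<le> m" "odd m" "a + 2 * m \<le> n"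
    and sq: "\<And>i. i < m \<Longrightarrow> w ! (a + i) = w ! (a + m + i)"
  shows False
proof -
  have shift: "E (e + m)" if "E e" "a < e" "e < a + m" for e
  proof -
    obtain i where i: "e = Suc (a + i)"
      using less_imp_Suc_add[OF \<open>a < e\<close>] by blast
    then have "Suc i < m" using that(3) by simp
    with i show ?thesis
      using that(1) sq[of i] sq[of "Suc i"] assms(3) E_Suc[of "a + i"] E_Suc[of "a + m + i"]
      by (simp add: ac_simps)
  qed
  \<comment> \<open>The word would begin with aabaaa, putting both 4 and 5 into
    \<open>E\<close>.\<close>
  have short: False if "a = 0" "m = 5" "n = 10" L
    using L_letters[OF that(4)] not_E_Suc[of 4] that sq[of 0] sq[of 1]
    by (auto simp: L_def E_Suc numeral_eq_Suc)
  obtain e where e: "E e" "a < e" "e \<le> a + 4"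
    using E_window[of "a + 1"] assms by (auto simp: ac_simps)
  have em: "E (e + m)" using shift e assms by simp
  from E_odd_distance[OF e(1) em] assms have "e = 1 \<and> L \<or> e + m = n - 1 \<and> R" by simp
  then show False
  proof
    assume *: "e = 1 \<and> L"
    then have "E 4" "E 1" "a = 0" using e by (auto simp: L_def)
    \<comment> \<open>Position 4 has a copy too; it can only be \<open>n - 1\<close>, and
      \<open>2 * m \<le> n\<close> then leaves \<open>m = 5\<close>.\<close>
    then have "E (4 + m)" using shift[of 4] assms by simp
    from E_odd_distance[OF \<open>E 4\<close> this] assms have "4 + m = n - 1" by simp
    then have "m = 5" "n = 10" using assms \<open>a = 0\<close> by linarith+
    then show False using short * \<open>a = 0\<close> by simp
  next
    assume *: "e + m = n - 1 \<and> R"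
    \<comment> \<open>\<open>e \<le> a + 4\<close> and \<open>a + 2 * m \<le> n\<close> give
      \<open>m \<le> 5\<close>.\<close>
    then have m: "m = 5" "n = a + 10" "e = a + 4" using assms e by linarith+
    then have "E (a + 6)" "E (a + 9)" using * by (simp_all add: R_def add.commute[of a])
    moreover have "w ! (a + 5) = w ! a" "w ! (a + 6) = w ! (a + 1)"
      using sq[of 0] sq[of 1] m by (simp_all add: add.commute[of a])
    \<comment> \<open>The repetition at \<open>n - 4 = a + 6\<close> is copied back by 5, an odd
      distance, which leads to \<open>L\<close> and the case \<open>short\<close>.\<close>
    ultimately have "E (a + 1)"
      by (simp add: E_def m add.commute[of a])
    with E_odd_distance[OF this \<open>E (a + 6)\<close>] m have "a = 0" L by auto
    then show False using short m by simp
  qed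
qed

text \<open>
  In the last alternative neither \<open>p\<close> nor, up to the exceptions \<open>L\<close> and \<open>R\<close>, an end of the square is
  in \<open>E\<close>; were there a letter beyond such an end, it would prolong the square to an overlap.
\<close>
lemma off_parity_centre:
  assumes n6: "6 \<le> n"
    and par: "\<And>e. E e \<Longrightarrow> even (e + c) \<or> e = 1 \<and> L \<or> e = n - 1 \<and> R"
    and centre: "square_centre w p" and off: "odd (p + c)"
  shows "(p = 1 \<or> p = 3) \<and> L \<or> (p = n - 1 \<or> p = n - 3) \<and> R \<or>
    \<not> E p \<and> (\<exists>a m. even m \<and> 4 \<le> m \<and> p = a + m \<and> (a = 0 \<or> a = 1 \<and> L) \<and>
      (a + 2 * m = n \<or> a + 2 * m = n - 1 \<and> R) \<and> (\<forall>i<m. w ! (a + i) = w ! (a + m + i)))"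
proof -
  obtain a m where m: "0 < m" and p: "p = a + m" and am: "a + 2 * m \<le> n"
    and sq: "\<And>i. i < m \<Longrightarrow> w ! (a + i) = w ! (a + m + i)"
    using centre by (rule square_centreE) blast
  have offE: "e = 1 \<and> L \<or> e = n - 1 \<and> R" if "E e" "odd (e + c)" for e
    using par that by blast
  consider "E p" | "m = 2" "\<not> E p" | "m = 3" "\<not> E p" | "odd m" "5 \<le> m"
    | "even m" "4 \<le> m" "\<not> E p"
  proof -
    have "E p" if "m = 1"
      using that sq[of 0] am p by (simp add: E_def)
    moreover have "m = 1 \<or> m = 2 \<or> m = 3 \<or> odd m \<and> 5 \<le> m \<or> even m \<and> 4 \<le> m"
      using m by presburger
    ultimately show thesis using that by blast
  qed
  then show ?thesis
  proof cases
    case 1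
    then show ?thesis using offE off by blast
  next
    case 2
    have w: "w ! (a + 2) = w ! a" "w ! (a + 3) = w ! (a + 1)"
      using sq[of 0] sq[of 1] 2 by (simp_all add: numeral_eq_Suc)
    have nE2: "\<not> E (a + 2)" using 2 p by simp
    then have nE: "\<not> E (a + 1)" "\<not> E (a + 3)"
      using w am 2 by (auto simp: E_def numeral_eq_Suc)
    show ?thesis
    \<comment> \<open>The square reads abab, so a window of four positions forces the next
      repetition to be at one of its ends, where the parity is wrong.\<close>
    proof (cases "a = 0")
      case True
      then have "E 4" using E_window[of 1] nE nE2 n6 by (simp add: numeral_eq_Suc)
      then have "4 = n - 1" using offE[of 4] off p 2 True by simp
      then show ?thesis using n6 by linarith
    next
      case False
      then have "E a" using E_window[of a] nE nE2 am 2 by auto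
      then have "a = 1 \<and> L" using offE[of a] off p 2 am by auto
      then show ?thesis using nE by (simp add: L_def)
    qed
  next
    case 3
    have w: "w ! (a + 3) = w ! a" "w ! (a + 4) = w ! (a + 1)" "w ! (a + 5) = w ! (a + 2)"
      using sq[of 0] sq[of 1] sq[of 2] 3 by (simp_all add: numeral_eq_Suc)
    have nE: "\<not> E (a + 3)" using 3 p by simp
    have n: "a + 6 \<le> n" using am 3 by simp
    \<comment> \<open>The first and third letters of the half differ, so the middle one equals one
      of them, and this repetition recurs 3 places later.\<close>
    have "E (a + 1) \<and> E (a + 4) \<or> E (a + 2) \<and> E (a + 5)"
      using w nE n by (auto simp: E_def numeral_eq_Suc)
    then show ?thesis
    proof
      assume E: "E (a + 1) \<and> E (a + 4)"
      have "a + 1 = 1 \<and> L \<or> a + 4 = n - 1 \<and> R"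
        by (rule E_odd_distance) (use E in auto)
      then show ?thesis using n p 3 by auto
    next
      assume E: "E (a + 2) \<and> E (a + 5)"
      have "a + 2 = 1 \<and> L \<or> a + 5 = n - 1 \<and> R"
        by (rule E_odd_distance) (use E in auto)
      then show ?thesis using n p 3 by auto
    qed
  next
    case 4
    then show ?thesis using no_odd_square am sq by blast
  next
    case 5
    have wp: "w ! (p - 1) \<noteq> w ! p" using 5 p am by (auto simp: E_def)
    have wa: "w ! p = w ! a" using sq[of 0] m p by simp
    have we: "w ! (a + 2 * m - 1) = w ! (p - 1)"
      using sq[of "m - 1"] m p by (simp add: mult_2 add.assoc)
    have "a = 0 \<or> a = 1 \<and> L"
    proof (cases "a = 0")
      case False
      have "E a"
      proof (rule ccontr)
        assume "\<not> E a"
        \<comment> \<open>Over two letters, both sides differ from \<open>w ! p\<close> and hence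
          agree.\<close>
        then have a1: "w ! (a - 1) = w ! (p - 1)"
          using False wp wa am m by (auto simp: E_def)
        have "\<forall>i\<le>m. w ! (a - 1 + i) = w ! (a - 1 + m + i)"
        proof (intro allI impI)
          fix i assume that: "i \<le> m"
          show "w ! (a - 1 + i) = w ! (a - 1 + m + i)"
          proof (cases i)
            case 0
            then show ?thesis using a1 False p by simp
          next
            case (Suc j)
            then show ?thesis using sq[of j] that False by simp
          qed
        qed
        moreover have "a - 1 + 2 * m < n" using False am by simp
        ultimately show False using overlap_free_nth[OF ovf m] by blast
      qed
      \<comment> \<open>As \<open>m\<close> is even, \<open>a\<close> has the parity of
        \<open>p\<close>.\<close>
      then show ?thesis using offE[of a] off p 5 am by auto
    qed simp
    moreover have "a + 2 * m = n \<or> a + 2 * m = n - 1 \<and> R"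
    proof (cases "a + 2 * m = n")
      case False
      then have less: "a + 2 * m < n" using am by simp
      have "E (a + 2 * m)"
      proof (rule ccontr)
        assume "\<not> E (a + 2 * m)"
        then have e: "w ! (a + 2 * m) = w ! (a + m)"
          using less m wp wa we p by (auto simp: E_def)
        have "w ! (a + i) = w ! (a + m + i)" if "i \<le> m" for i
          using that sq e by (cases "i = m") (auto simp: mult_2 add.assoc)
        then show False
          using overlap_free_nth[OF ovf m less] by blast
      qed
      then show ?thesis using offE[of "a + 2 * m"] off p 5 by auto
    qed simp
    ultimately show ?thesis using 5 p sq by blast
  qed
qed

text \<open>The square copies letters of the prefix to just after its centre and letters of the
  suffix to just before it. Both sides alternate, and without a repetition at the centre the
  alternation would run through.\<close>

lemma spanning_square_centre:
  assumes L R "4 \<le> m" "n = 2 * m + 2"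
    and sq: "\<And>i. i < m \<Longrightarrow> w ! (1 + i) = w ! (1 + m + i)"
  shows "E (m + 1)"
proof (rule ccontr)
  assume nE: "\<not> E (m + 1)"
  \<comment> \<open>The five letters around \<open>m + 1\<close> are then an overlap \<open>yxyxy\<close>.\<close>
  define k where "k = m - 4"
  have m: "m = k + 4" using assms(3) by (simp add: k_def)
  have n: "n = (2 * k + 5) + 5" using assms(4) m by simp
  note l = L_letters[OF assms(1)] and r = R_letters[OF assms(2) n]
  have front: "w ! (k + 5) = w ! 1" "w ! (k + 6) = w ! 2"
    using sq[of 0] sq[of 1] m by (simp_all add: numeral_eq_Suc)
  have rear: "w ! (k + 2) = w ! (2 * k + 6)" "w ! (k + 3) = w ! (2 * k + 7)"
    "w ! (k + 4) = w ! (2 * k + 8)"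
    using sq[of "k + 1"] sq[of "k + 2"] sq[of "k + 3"] m
    by (simp_all add: numeral_eq_Suc mult_2)
  have "w ! (k + 4) \<noteq> w ! (k + 5)"
    using nE m n by (auto simp: E_Suc numeral_eq_Suc)
  moreover have "w ! (k + 3) = (\<not> w ! (k + 2))" "w ! (k + 4) = w ! (k + 2)"
    using rear r by (simp_all add: numeral_eq_Suc)
  moreover have "w ! (k + 6) = (\<not> w ! (k + 5))"
    using front l by simp
  ultimately have "w ! (k + 2 + i) = w ! (k + 2 + 2 + i)" if "i \<le> 2" for i
    using that by (auto simp: le_Suc_eq numeral_eq_Suc)
  moreover have "k + 2 + 2 * 2 < n" using n by simp
  ultimately show False
    using overlap_free_nth[OF ovf, of 2 "k + 2"] by (meson zero_less_numeral)
qed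

section \<open>Counting the centres\<close>

lemma two_M_le: "2 * M w \<le> n + 3"
proof (cases "6 \<le> n")
  case False
  \<comment> \<open>For \<open>n \<le> 5\<close> the trivial bound \<open>n - 1\<close>
    suffices.\<close>
  have "M w \<le> card {1..<n}"
    unfolding M_def by (intro card_mono) (auto simp: square_centre_def)
  then show ?thesis using False by simp
next
  case n6: True
  obtain c where par: "\<And>e. E e \<Longrightarrow> even (e + c) \<or> e = 1 \<and> L \<or> e = n - 1 \<and> R"
    and Lc: "L \<Longrightarrow> even c" and Rc: "R \<Longrightarrow> even (n + c)"
    using E_parity[OF n6] by blast
  define P where "P = {p. 1 \<le> p \<and> p < n \<and> even (p + c)}"
  \<comment> \<open>\<open>A\<close> collects positions of the main parity that are not centres,
    \<open>B\<close> covers all centres of the other parity.\<close>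
  have count: "M w + card A \<le> card P + card B"
    if "A \<subseteq> P" "finite B" "\<And>p. square_centre w p \<Longrightarrow> p \<notin> A"
      "\<And>p. square_centre w p \<Longrightarrow> odd (p + c) \<Longrightarrow> p \<in> B" for A B
  proof -
    have fin: "finite P" unfolding P_def by simp
    have "{p. square_centre w p} \<subseteq> (P - A) \<union> B"
      using that(3,4) unfolding P_def square_centre_def by auto
    then have "M w \<le> card ((P - A) \<union> B)"
      unfolding M_def using fin that(2) by (intro card_mono) auto
    also have "\<dots> \<le> card (P - A) + card B"
      by (rule card_Un_le)
    finally show ?thesis
      using card_Diff_subset[OF finite_subset[OF that(1) fin] that(1)]
        card_mono[OF fin that(1)] by simp
  qed
  have card_odd: "card P = n div 2" if "odd c"
  proof -
    have "P = (\<lambda>i. 2 * i + 1) ` {..<n div 2}"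
      using that by (auto simp: P_def elim!: oddE intro!: image_eqI)
    then show ?thesis by (simp add: card_image inj_on_def)
  qed
  have card_even: "card P = (n - 1) div 2" if "even c"
  proof -
    have "P = (\<lambda>i. 2 * i) ` {1..(n - 1) div 2}"
      using that by (auto simp: P_def elim!: evenE intro!: image_eqI)
    then show ?thesis by (simp add: card_image inj_on_def)
  qed
  note off = off_parity_centre[OF n6 par]
  show ?thesis
  proof (cases L; cases R)
    assume "\<not> L" "\<not> R"
    then have "p \<in> {n div 2}" if "square_centre w p" "odd (p + c)" for p
      using off[OF _ that] by auto
    then have "M w + card ({} :: nat set) \<le> card P + card {n div 2}"
      by (intro count) auto
    moreover have "card P \<le> n div 2"
      using card_odd card_even by (cases "even c") auto
    ultimately show ?thesis by simp
  next
    assume "L" "\<not> R"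
    \<comment> \<open>Here \<open>c\<close> and \<open>m\<close> are even, so
      \<open>p = a + m\<close> odd means \<open>a = 1\<close> and
      \<open>n = 2 * m + 1\<close>.\<close>
    then have "p \<in> {1, 3, (n + 1) div 2}" if "square_centre w p" "odd (p + c)" for p
      using off[OF _ that] Lc that(2) by auto
    moreover have "2 \<in> P" using Lc \<open>L\<close> n6 by (simp add: P_def)
    ultimately have "M w + card {2::nat} \<le> card P + card {1, 3, (n + 1) div 2}"
      using L_not_centre \<open>L\<close> by (intro count) auto
    moreover have "card {1, 3, (n + 1) div 2} \<le> 3"
      using card_length[of "[1, 3, (n + 1) div 2]"] by simp
    ultimately show ?thesis using card_even Lc \<open>L\<close> n6 by simp
  next
    assume "\<not> L" "R"
    then have "p \<in> {n - 1, n - 3, (n - 1) div 2}" if "square_centre w p" "odd (p + c)" for p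
    proof -
      from off[OF _ that] \<open>\<not> L\<close> consider "p = n - 1 \<or> p = n - 3"
        | m where "even m" "p = m" "2 * m = n \<or> 2 * m = n - 1"
        by auto
      then show ?thesis
      proof cases
        case (2 m)
        then have "odd n" using Rc \<open>R\<close> that(2) by simp
        then have "2 * m = n - 1" using 2 by (metis dvd_triv_left)
        then have "(n - 1) div 2 = p" using 2(2) by simp
        then show ?thesis by simp
      qed blast
    qed
    moreover have "n - 2 \<in> P" using Rc \<open>R\<close> n6 by (auto simp: P_def)
    ultimately have "M w + card {n - 2} \<le> card P + card {n - 1, n - 3, (n - 1) div 2}"
      using R_not_centre n6 \<open>R\<close> by (intro count) auto
    moreover have "card {n - 1, n - 3, (n - 1) div 2} \<le> 3"
      using card_length[of "[n - 1, n - 3, (n - 1) div 2]"] by simp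
    \<comment> \<open>\<open>R\<close> gives \<open>c\<close> the parity of \<open>n\<close>, so the
      two counts agree when \<open>c\<close> is odd.\<close>
    moreover have "card P = (n - 1) div 2"
    proof (cases "even c")
      case False
      then have "odd n" using Rc \<open>R\<close> by simp
      then show ?thesis using card_odd False by (auto elim!: oddE)
    qed (use card_even in simp)
    ultimately show ?thesis using n6 by (simp; linarith)
  next
    assume "L" "R"
    then have ev: "even c" "even n" using Lc Rc by auto
    have "p \<in> {1, 3, n - 1, n - 3}" if p: "square_centre w p" "odd (p + c)" for p
    proof (rule ccontr)
      assume "p \<notin> {1, 3, n - 1, n - 3}"
      then obtain a m where m: "\<not> E p" "even m" "4 \<le> m" "p = a + m" "a = 0 \<or> a = 1"
        "a + 2 * m = n \<or> a + 2 * m = n - 1" "\<forall>i<m. w ! (a + i) = w ! (a + m + i)"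
        using off[OF _ p] by blast
      \<comment> \<open>\<open>p\<close> is odd and \<open>m\<close> even; as \<open>n\<close> is
        even, one letter remains at each end.\<close>
      have a: "a = 1" using m p(2) ev by auto
      then have "n = 2 * m + 2" using m(6) ev(2) n6 by presburger
      then have "E (m + 1)"
        using spanning_square_centre[OF \<open>L\<close> \<open>R\<close> m(3)] m(7) a by simp
      then show False using m a by simp
    qed
    moreover have "{2, n - 2} \<subseteq> P" using ev n6 by (auto simp: P_def)
    ultimately have "M w + card {2, n - 2} \<le> card P + card {1, 3, n - 1, n - 3}"
      using L_not_centre R_not_centre n6 \<open>L\<close> \<open>R\<close> by (intro count) auto
    moreover have "card {1, 3, n - 1, n - 3} \<le> 4"
      using card_length[of "[1, 3, n - 1, n - 3]"] by simp
    moreover have "card {2, n - 2} = 2" using n6 by simp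
    ultimately show ?thesis using card_even ev n6 by simp
  qed
qed

end

theorem theorem4:
  fixes w :: binary_word
  assumes "overlap_free w"
  shows "int (M w) \<le> \<lceil>real (length w) / 2\<rceil> + 1 \<and> 2 * M w \<le> length w + 3"
proof -
  interpret overlap_free_word w
    using assms by unfold_locales
  have "2 * M w \<le> length w + 3" by (rule two_M_le)
  moreover have "int (M w) \<le> \<lceil>real (length w) / 2\<rceil> + 1"
    using two_M_le by linarith
  ultimately show ?thesis by blast
qed

end
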